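(* Let $m,n,p$ be positive integers. For each $j\in[p]$, let $f_j:\{0,1\}^n\to\mathbb{R}_+$ be a nonnegative function, let $\mathbb{K}_j\subseteq\mathbb{R}^{k_j}$ be a closed convex pointed cone, and let $A^j\in\mathbb{R}^{k_j\times m}$, $B^j\in\mathbb{R}^{k_j}$. Define $$\mathcal{S}=\left\{(x,z)\in\mathbb{R}^{mp}\times\{0,1\}^n:\ \exists y\in\mathbb{R}^p\text{ s.t. } y_j\ge f_j(z)\ \text{ and }\ A^jx^j+B^jy_j\in\mathbb{K}_j\ \ \forall j\in[p]\right\},$$ $$\mathcal{G}=\left\{(y,z)\in\mathbb{R}^p\times\{0,1\}^n:\ y_j\ge f_j(z)\ \ \forall j\in[p]\right\},$$ $$\widehat{\mathcal{S}}=\left\{(x,z)\in\mathbb{R}^{mp}\times[0,1]^n:\ \exists y\in\mathbb{R}^p\text{ s.t. }(y,z)\in\operatorname{conv}(\mathcal{G})\ \text{ and }\ A^jx^j+B^jy_j\in\mathbb{K}_j\ \ \forall j\in[p]\right\}.$$ Then $\operatorname{conv}(\mathcal{S})=\widehat{\mathcal{S}}$.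
   Context: $[p]=\{1,\dots,p\}$. A vector $x\in\mathbb{R}^{mp}$ is partitioned as $x=(x^1,\dots,x^p)$ with $x^j\in\mathbb{R}^m$; $y=(y_1,\dots,y_p)\in\mathbb{R}^p$. $\operatorname{conv}$ denotes the convex hull. A closed convex cone is pointed if it contains no line, i.e. $\mathbb{K}\cap(-\mathbb{K})=\{0\}$. *)

theory Defs
  imports "HOL-Analysis.Analysis" "HOL-Library.Function_Algebras"
begin

text \<open>
  The cones live in \<open>\<real>\<^bsup>k j\<^esup>\<close>, with a dimension that depends on the block \<open>j\<close>, so these spaces
  cannot be given by an index type. We use the library's \<^const>\<open>Euclidean_space\<close>, whose points
  are the functions \<^typ>\<open>nat \<Rightarrow> real\<close> vanishing at all indices \<open>i \<ge> k j\<close>. The pointwise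
  vector space structure on functions makes \<^const>\<open>convex_cone\<close> applicable to sets of such
  points.
\<close>

instantiation "fun" :: (type, real_vector) real_vector
begin

definition scaleR_fun :: "real \<Rightarrow> ('a \<Rightarrow> 'b) \<Rightarrow> 'a \<Rightarrow> 'b"
  where "scaleR_fun c f = (\<lambda>i. c *\<^sub>R f i)"

instance
  by standard (simp_all add: scaleR_fun_def fun_eq_iff scaleR_add_right scaleR_add_left)

end

definition pointed :: "'a::real_vector set \<Rightarrow> bool"
  where "pointed K \<longleftrightarrow> K \<inter> uminus ` K = {0}"

definition closed_convex_pointed_cone :: "nat \<Rightarrow> (nat \<Rightarrow> real) set \<Rightarrow> bool"
  where "closed_convex_pointed_cone k K \<longleftrightarrow>
    closedin (Euclidean_space k) K \<and> convex_cone K \<and> pointed K"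

text \<open>
  The vector \<open>A x + t B\<close> of \<open>\<real>\<^bsup>k\<^esup>\<close>, where \<open>A\<close> is a matrix with rows \<open>i < k\<close> and columns in \<open>'m\<close>,
  and \<open>B\<close> is a vector with entries \<open>i < k\<close>. Entries at \<open>i \<ge> k\<close> are ignored.
\<close>

definition cone_map ::
    "nat \<Rightarrow> (nat \<Rightarrow> 'm \<Rightarrow> real) \<Rightarrow> (nat \<Rightarrow> real) \<Rightarrow> real ^ 'm \<Rightarrow> real \<Rightarrow> nat \<Rightarrow> real"
  where "cone_map k A B x t =
    (\<lambda>i. if i < k then (\<Sum>l\<in>UNIV. A i l * x $ l) + B i * t else 0)"

definition binary_cube :: "(real ^ 'n) set"
  where "binary_cube = {z. \<forall>i. z $ i \<in> {0, 1}}"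

definition unit_cube :: "(real ^ 'n) set"
  where "unit_cube = {z. \<forall>i. z $ i \<in> {0..1}}"

text \<open>
  The index set \<open>[p]\<close> is the finite type \<open>'p\<close>, and \<open>x :: real ^ 'm ^ 'p\<close> has the blocks \<open>x $ j\<close>.
  The functions \<open>f j\<close> are only evaluated on \<^const>\<open>binary_cube\<close>.
\<close>

definition S_set ::
    "('p \<Rightarrow> real ^ 'n \<Rightarrow> real) \<Rightarrow> ('p \<Rightarrow> nat) \<Rightarrow> ('p \<Rightarrow> (nat \<Rightarrow> real) set) \<Rightarrow>
     ('p \<Rightarrow> nat \<Rightarrow> 'm \<Rightarrow> real) \<Rightarrow> ('p \<Rightarrow> nat \<Rightarrow> real) \<Rightarrow> ((real ^ 'm ^ 'p) \<times> (real ^ 'n)) set"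
  where "S_set f k K A B =
    {(x, z). z \<in> binary_cube \<and>
      (\<exists>y :: real ^ 'p. \<forall>j. y $ j \<ge> f j z \<and> cone_map (k j) (A j) (B j) (x $ j) (y $ j) \<in> K j)}"

definition G_set :: "('p \<Rightarrow> real ^ 'n \<Rightarrow> real) \<Rightarrow> ((real ^ 'p) \<times> (real ^ 'n)) set"
  where "G_set f = {(y, z). z \<in> binary_cube \<and> (\<forall>j. y $ j \<ge> f j z)}"

definition S_hat ::
    "('p \<Rightarrow> real ^ 'n \<Rightarrow> real) \<Rightarrow> ('p \<Rightarrow> nat) \<Rightarrow> ('p \<Rightarrow> (nat \<Rightarrow> real) set) \<Rightarrow>
     ('p \<Rightarrow> nat \<Rightarrow> 'm \<Rightarrow> real) \<Rightarrow> ('p \<Rightarrow> nat \<Rightarrow> real) \<Rightarrow> ((real ^ 'm ^ 'p) \<times> (real ^ 'n)) set"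
  where "S_hat f k K A B =
    {(x, z). z \<in> unit_cube \<and>
      (\<exists>y :: real ^ 'p. (y, z) \<in> convex hull (G_set f) \<and>
        (\<forall>j. cone_map (k j) (A j) (B j) (x $ j) (y $ j) \<in> K j))}"

end

theory Submission
  imports Defs
begin

text \<open>
  Since \<^const>\<open>S_hat\<close> is a convex set that contains \<^const>\<open>S_set\<close>, only the inclusion of
  \<^const>\<open>S_hat\<close> in the convex hull of \<^const>\<open>S_set\<close> needs an idea.

  Let \<open>(x, z)\<close> belong to \<^const>\<open>S_hat\<close> with witness \<open>y\<close>, and write \<open>(y, z)\<close> as a convex
  combination of points \<open>(v, w)\<close> of \<^const>\<open>G_set\<close>. A point \<open>(v, w)\<close> is lifted to \<open>(x', w)\<close>, where
  \<open>x'\<close> has the blocks \<open>(v\<^sub>j / y\<^sub>j) x\<^sup>j\<close>: then \<open>A\<^sup>j x'\<^sup>j + B\<^sup>j v\<^sub>j\<close> is the multiple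
  \<open>v\<^sub>j / y\<^sub>j \<ge> 0\<close> of the vector \<open>A\<^sup>j x\<^sup>j + B\<^sup>j y\<^sub>j\<close>, so it stays in the cone, and \<open>(x', w)\<close> lies in
  \<^const>\<open>S_set\<close>. The lifting is affine in \<open>(v, w)\<close> and sends \<open>(y, z)\<close> to \<open>(x, z)\<close>, hence
  \<open>(x, z)\<close> is the same convex combination of the lifted points.

  The quotient makes no sense in the blocks with \<open>y\<^sub>j = 0\<close>. There the nonnegativity of \<open>f\<^sub>j\<close>
  helps: the coordinate \<open>v\<^sub>j\<close> is never negative, so every point of positive weight in the
  convex combination has \<open>v\<^sub>j = 0\<close> too (lemma \<open>convex_hull_vanishing_functionals\<close>), and the
  block \<open>x\<^sup>j\<close> can be kept unchanged.
\<close>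

text \<open>
  A convex combination of nonnegative numbers vanishes only if every number of positive weight
  does. So the points of positive weight already represent \<open>a\<close> and lie in the face of the
  convex hull cut out by the functionals that vanish at \<open>a\<close>.
\<close>

lemma convex_hull_vanishing_functionals:
  fixes \<phi> :: "'i \<Rightarrow> 'a::real_vector \<Rightarrow> real"
  assumes lin: "\<And>j. linear (\<phi> j)"
    and nonneg: "\<And>j v. v \<in> G \<Longrightarrow> 0 \<le> \<phi> j v"
    and a: "a \<in> convex hull G"
  shows "a \<in> convex hull {v \<in> G. \<forall>j. \<phi> j a = 0 \<longrightarrow> \<phi> j v = 0}"
proof -
  obtain S u where S: "finite S" "S \<subseteq> G" and u: "\<forall>v\<in>S. 0 \<le> u v" "sum u S = 1"
    and sum_a: "(\<Sum>v\<in>S. u v *\<^sub>R v) = a"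
    using a unfolding convex_hull_explicit by blast
  define P where "P = {v \<in> S. u v \<noteq> 0}"
  have P: "finite P" "P \<subseteq> S"
    using S by (auto simp: P_def)
  have "sum u P = sum u S"
    using S(1) by (intro sum.mono_neutral_left) (auto simp: P_def)
  moreover have "(\<Sum>v\<in>P. u v *\<^sub>R v) = (\<Sum>v\<in>S. u v *\<^sub>R v)"
    using S(1) by (intro sum.mono_neutral_left) (auto simp: P_def)
  moreover have "\<phi> j v = 0" if "v \<in> P" "\<phi> j a = 0" for j v
  proof -
    have "(\<Sum>w\<in>S. u w * \<phi> j w) = 0"
      using that(2) by (simp flip: sum_a add: linear_sum[OF lin] linear_scale[OF lin])
    moreover have "0 \<le> u w * \<phi> j w" if "w \<in> S" for w
      using that S(2) u(1) nonneg by (intro mult_nonneg_nonneg) auto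
    ultimately have "u v * \<phi> j v = 0"
      using S(1) P(2) that(1) by (simp add: sum_nonneg_eq_0_iff subset_iff)
    then show ?thesis
      using that(1) by (simp add: P_def)
  qed
  ultimately show ?thesis
    using S u P sum_a unfolding convex_hull_explicit
    by (intro CollectI exI[of _ P] exI[of _ u]) auto
qed

lemma cone_map_linear_combination:
  "cone_map k A B (a *\<^sub>R x + b *\<^sub>R x') (a * t + b * t') =
     a *\<^sub>R cone_map k A B x t + b *\<^sub>R cone_map k A B x' t'"
  by (simp add: cone_map_def fun_eq_iff scaleR_fun_def algebra_simps sum.distrib sum_distrib_left)

lemma cone_map_scaleR:
  "cone_map k A B (a *\<^sub>R x) (a * t) = a *\<^sub>R cone_map k A B x t"
  using cone_map_linear_combination[of k A B a x 0 0 t 0] by simp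

lemma binary_cube_subset_unit_cube: "binary_cube \<subseteq> unit_cube"
proof
  fix z :: "real ^ 'a"
  assume "z \<in> binary_cube"
  then have "z $ i = 0 \<or> z $ i = 1" for i
    by (simp add: binary_cube_def)
  then have "0 \<le> z $ i \<and> z $ i \<le> 1" for i
    by (metis order_refl zero_le_one)
  then show "z \<in> unit_cube"
    by (simp add: unit_cube_def)
qed

lemma convex_unit_cube: "convex unit_cube"
  unfolding convex_def unit_cube_def by (auto intro!: add_nonneg_nonneg convex_bound_le)

lemma S_set_subset_S_hat: "S_set f k K A B \<subseteq> S_hat f k K A B"
proof clarify
  fix x z
  assume "(x, z) \<in> S_set f k K A B"
  then obtain y where z: "z \<in> binary_cube"
    and y: "\<And>j. f j z \<le> y $ j" "\<And>j. cone_map (k j) (A j) (B j) (x $ j) (y $ j) \<in> K j"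
    unfolding S_set_def by blast
  then have "(y, z) \<in> convex hull G_set f"
    by (intro hull_inc) (simp add: G_set_def)
  then show "(x, z) \<in> S_hat f k K A B"
    using z y binary_cube_subset_unit_cube unfolding S_hat_def by blast
qed

lemma convex_S_hat:
  assumes "\<And>j. convex (K j)"
  shows "convex (S_hat f k K A B)"
proof (rule convexI, clarify)
  fix x z x' z' and a b :: real
  assume ab: "0 \<le> a" "0 \<le> b" "a + b = 1"
    and "(x, z) \<in> S_hat f k K A B" "(x', z') \<in> S_hat f k K A B"
  then obtain y y' where z: "z \<in> unit_cube" "z' \<in> unit_cube"
    and y: "(y, z) \<in> convex hull G_set f" "(y', z') \<in> convex hull G_set f"
    and K: "\<And>j. cone_map (k j) (A j) (B j) (x $ j) (y $ j) \<in> K j"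
      "\<And>j. cone_map (k j) (A j) (B j) (x' $ j) (y' $ j) \<in> K j"
    unfolding S_hat_def by blast
  have "a *\<^sub>R z + b *\<^sub>R z' \<in> unit_cube"
    using convexD[OF convex_unit_cube] z ab by blast
  moreover have "(a *\<^sub>R y + b *\<^sub>R y', a *\<^sub>R z + b *\<^sub>R z') \<in> convex hull G_set f"
    using convexD[OF convex_convex_hull y ab] by simp
  moreover have "cone_map (k j) (A j) (B j) ((a *\<^sub>R x + b *\<^sub>R x') $ j) ((a *\<^sub>R y + b *\<^sub>R y') $ j) \<in> K j"
    for j
    using convexD[OF assms K ab] by (simp add: cone_map_linear_combination)
  ultimately show "a *\<^sub>R (x, z) + b *\<^sub>R (x', z') \<in> S_hat f k K A B"
    unfolding S_hat_def by auto
qed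

text \<open>
  The set \<open>F\<close> consists of points of \<^const>\<open>G_set\<close> that lift into \<^const>\<open>S_set\<close>; the
  lifting is the map \<open>T\<close>. As \<open>T\<close> is affine, the points that it sends into the convex hull of
  \<^const>\<open>S_set\<close> form a convex set, which contains the convex hull of \<open>F\<close>.
\<close>

lemma S_hat_subset_convex_hull_S_set:
  fixes f :: "'p::finite \<Rightarrow> real ^ 'n::finite \<Rightarrow> real"
    and A :: "'p \<Rightarrow> nat \<Rightarrow> 'm::finite \<Rightarrow> real"
  assumes f: "\<And>j z. z \<in> binary_cube \<Longrightarrow> 0 \<le> f j z"
    and K: "\<And>j. conic (K j)"
  shows "S_hat f k K A B \<subseteq> convex hull S_set f k K A B"
proof clarify
  fix x z
  assume "(x, z) \<in> S_hat f k K A B"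
  then obtain y where yz: "(y, z) \<in> convex hull G_set f"
    and yK: "\<And>j. cone_map (k j) (A j) (B j) (x $ j) (y $ j) \<in> K j"
    unfolding S_hat_def by blast
  define \<phi> where "\<phi> j g = fst g $ j" for j and g :: "(real ^ 'p) \<times> (real ^ 'n)"
  define F where "F = {g \<in> G_set f. \<forall>j. \<phi> j (y, z) = 0 \<longrightarrow> \<phi> j g = 0}"
  have G_nonneg: "0 \<le> \<phi> j g" if "g \<in> G_set f" for j g
  proof -
    have "0 \<le> f j (snd g)" "f j (snd g) \<le> fst g $ j"
      using that f by (auto simp: G_set_def)
    then show ?thesis
      by (simp add: \<phi>_def)
  qed
  have "linear (\<phi> j)" for j
    by (rule linearI) (simp_all add: \<phi>_def)
  with yz G_nonneg have yz_F: "(y, z) \<in> convex hull F"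
    unfolding F_def by (intro convex_hull_vanishing_functionals) auto
  have "convex hull G_set f \<subseteq> {g. \<forall>j. 0 \<le> \<phi> j g}"
    using G_nonneg by (intro hull_minimal) (auto simp: convex_def \<phi>_def)
  then have y_nonneg: "0 \<le> y $ j" for j
    using yz by (auto simp: \<phi>_def)

  define c where "c j t = (if y $ j = 0 then 1 else t / y $ j)" for j and t :: real
  define T where "T g = ((\<chi> j. c j (fst g $ j) *\<^sub>R x $ j), snd g)"
    for g :: "(real ^ 'p) \<times> (real ^ 'n)"
  have T_affine: "T (a *\<^sub>R g + b *\<^sub>R g') = a *\<^sub>R T g + b *\<^sub>R T g'" if "a + b = 1" for a b g g'
  proof -
    have "c j (a * s + b * t) = a * c j s + b * c j t" for j s t
      using that by (simp add: c_def add_divide_distrib)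
    then show ?thesis
      by (simp add: T_def vec_eq_iff prod_eq_iff distrib_right mult.assoc)
  qed
  have T_S_set: "T (v, w) \<in> S_set f k K A B" if vw: "(v, w) \<in> F" for v w
  proof -
    have "cone_map (k j) (A j) (B j) (c j (v $ j) *\<^sub>R x $ j) (v $ j) \<in> K j" for j
    proof -
      \<comment> \<open>If \<open>y\<^sub>j = 0\<close>, this holds because \<open>F\<close> forces \<open>v\<^sub>j = 0\<close>.\<close>
      have "v $ j = c j (v $ j) * y $ j"
        using vw by (auto simp: F_def \<phi>_def c_def)
      moreover have "0 \<le> c j (v $ j)"
        using vw G_nonneg[of "(v, w)" j] y_nonneg[of j] by (simp add: F_def \<phi>_def c_def)
      ultimately show ?thesis
        using K[of j] yK[of j] cone_map_scaleR[of "k j" "A j" "B j" "c j (v $ j)" "x $ j" "y $ j"]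
        unfolding conic_def by metis
    qed
    then show ?thesis
      using vw by (auto simp: F_def G_set_def S_set_def T_def)
  qed
  have "convex {g. T g \<in> convex hull S_set f k K A B}"
    by (rule convexI) (auto simp: T_affine intro: convexD[OF convex_convex_hull])
  then have "convex hull F \<subseteq> {g. T g \<in> convex hull S_set f k K A B}"
    using T_S_set by (intro hull_minimal) (auto intro: hull_inc)
  then have "T (y, z) \<in> convex hull S_set f k K A B"
    using yz_F by blast
  moreover have "T (y, z) = (x, z)"
    by (simp add: T_def c_def vec_eq_iff)
  ultimately show "(x, z) \<in> convex hull S_set f k K A B"
    by simp
qed

theorem theorem2:
  fixes f :: "'p::finite \<Rightarrow> real ^ 'n::finite \<Rightarrow> real"
    and k :: "'p \<Rightarrow> nat"
    and K :: "'p \<Rightarrow> (nat \<Rightarrow> real) set"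
    and A :: "'p \<Rightarrow> nat \<Rightarrow> 'm::finite \<Rightarrow> real"
    and B :: "'p \<Rightarrow> nat \<Rightarrow> real"
  assumes "\<And>j z. z \<in> binary_cube \<Longrightarrow> 0 \<le> f j z"
    and "\<And>j. closed_convex_pointed_cone (k j) (K j)"
  shows "convex hull (S_set f k K A B) = S_hat f k K A B"
proof
  have "convex (K j)" and K: "conic (K j)" for j
    using assms(2)[of j] by (auto simp: closed_convex_pointed_cone_def convex_cone_def)
  then show "convex hull (S_set f k K A B) \<subseteq> S_hat f k K A B"
    by (intro hull_minimal S_set_subset_S_hat convex_S_hat)
  show "S_hat f k K A B \<subseteq> convex hull (S_set f k K A B)"
    using assms(1) K by (rule S_hat_subset_convex_hull_S_set)
qed

end
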